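(* For $\mu,\alpha\in\mathbb{R}$ and $\varepsilon\ge 0$ consider the linear $2\pi$-periodic Hamiltonian system with Hamiltonian $$H(\xi,\eta,\tau)=\tfrac12\eta^2+\tfrac12\left[\varepsilon\cos\tau+\alpha+\tfrac{\mu}{4}\right]\xi^2 ,$$ i.e. $\xi'=\eta$, $\eta'=-\left(\varepsilon\cos\tau+\alpha+\frac{\mu}{4}\right)\xi$. For each $\mu\in\mathbb{R}$, the boundary between the stability and instability regions emanating from the resonance point $\alpha=\alpha_0=\frac{1-\mu}{4}$, $\varepsilon=0$ consists of the two curves $\alpha=\alpha_{-}(\mu,\varepsilon)$ and $\alpha=\alpha_{+}(\mu,\varepsilon)$ with, as $\varepsilon\to0^+$, $$\alpha_{\mp}(\mu,\varepsilon)=\frac{1-\mu}{4}\mp\frac12\varepsilon-\frac18\varepsilon^2\pm\frac1{32}\varepsilon^3-\frac1{384}\varepsilon^4\mp\frac{11}{4608}\varepsilon^5+\mathcal{O}(\varepsilon^6)$$ (upper signs for $\alpha_-$, lower signs for $\alpha_+$). The instability region associated with this resonance is the region between the two curves.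
   Context: The system is the linearization at the equilibrium $P_1=(0,0)$ of the charged pendulum with Hamiltonian $\frac12 y^2-\alpha\cos x-\varepsilon\cos\tau\cos x-\frac{\mu}{2}\log(7+\cos2x)$. A linear periodic system is stable if all its solutions are bounded for all $\tau\in\mathbb{R}$, and unstable otherwise. The point $(\mu,\alpha_0,0)$ is the resonance $2\omega=N$ with $N=1$, where $\omega^2=\frac{\mu}{4}+\alpha_0$. "The boundary emanating from $(\alpha_0,0)$ consists of the two curves $\alpha_\pm$, with instability region between them" means: there are $\varepsilon_0>0$ and $\delta>0$ (for fixed $\mu$) such that $\alpha_\pm(\mu,\cdot)$ are defined on $[0,\varepsilon_0)$, equal $\alpha_0$ at $\varepsilon=0$, and for $0<\varepsilon<\varepsilon_0$, $|\alpha-\alpha_0|<\delta$, the system is unstable when $\alpha$ lies strictly between the two curves and stable when $\alpha$ is strictly outside the closed interval they bound. As $\mu$ varies these curves form surfaces in the parameter space $(\mu,\alpha,\varepsilon)$. *)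

theory Defs
  imports "HOL-Analysis.Analysis" "HOL-Library.Landau_Symbols"
begin

definition hamiltonian_solution ::
  "(real \<Rightarrow> real \<Rightarrow> real \<Rightarrow> real) \<Rightarrow> (real \<Rightarrow> real) \<Rightarrow> (real \<Rightarrow> real) \<Rightarrow> bool" where
  "hamiltonian_solution H \<xi> \<eta> \<longleftrightarrow>
     (\<forall>\<tau>. (\<xi> has_real_derivative deriv (\<lambda>y. H (\<xi> \<tau>) y \<tau>) (\<eta> \<tau>)) (at \<tau>) \<and>
          (\<eta> has_real_derivative - deriv (\<lambda>x. H x (\<eta> \<tau>) \<tau>) (\<xi> \<tau>)) (at \<tau>))"

definition stable :: "(real \<Rightarrow> real \<Rightarrow> real \<Rightarrow> real) \<Rightarrow> bool" where
  "stable H \<longleftrightarrow>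
     (\<forall>\<xi> \<eta>. hamiltonian_solution H \<xi> \<eta> \<longrightarrow> bounded (range (\<lambda>\<tau>. (\<xi> \<tau>, \<eta> \<tau>))))"

abbreviation unstable :: "(real \<Rightarrow> real \<Rightarrow> real \<Rightarrow> real) \<Rightarrow> bool" where
  "unstable H \<equiv> \<not> stable H"

definition linearized_H :: "real \<Rightarrow> real \<Rightarrow> real \<Rightarrow> real \<Rightarrow> real \<Rightarrow> real \<Rightarrow> real" where
  "linearized_H \<mu> \<alpha> \<epsilon> \<xi> \<eta> \<tau> =
     1/2 * \<eta>\<^sup>2 + 1/2 * (\<epsilon> * cos \<tau> + \<alpha> + \<mu>/4) * \<xi>\<^sup>2"

lemma hamiltonian_solution_linearized_H_iff:
  "hamiltonian_solution (linearized_H \<mu> \<alpha> \<epsilon>) \<xi> \<eta> \<longleftrightarrow>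
     (\<forall>\<tau>. (\<xi> has_real_derivative \<eta> \<tau>) (at \<tau>) \<and>
          (\<eta> has_real_derivative - (\<epsilon> * cos \<tau> + \<alpha> + \<mu>/4) * \<xi> \<tau>) (at \<tau>))"
proof -
  have "deriv (\<lambda>y. linearized_H \<mu> \<alpha> \<epsilon> x y \<tau>) y = y" for x y \<tau>
    unfolding linearized_H_def
    by (rule DERIV_imp_deriv) (auto intro!: derivative_eq_intros)
  moreover have "deriv (\<lambda>x. linearized_H \<mu> \<alpha> \<epsilon> x y \<tau>) x = (\<epsilon> * cos \<tau> + \<alpha> + \<mu>/4) * x" for x y \<tau>
    unfolding linearized_H_def
    by (rule DERIV_imp_deriv) (auto intro!: derivative_eq_intros)
  ultimately show ?thesis
    by (simp only: hamiltonian_solution_def minus_mult_left)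
qed

definition resonance_alpha :: "real \<Rightarrow> real" where
  "resonance_alpha \<mu> = (1 - \<mu>) / 4"

text \<open>
  The curves are total functions of \<open>\<epsilon>\<close>; only their values on \<open>{0..<\<epsilon>\<^sub>0}\<close> are constrained.
  For reals, \<open>open_segment a b\<close> and \<open>closed_segment a b\<close> are the open and closed
  intervals with endpoints \<open>a\<close> and \<open>b\<close>, in whichever order.
\<close>

definition stability_boundary :: "real \<Rightarrow> (real \<Rightarrow> real) \<Rightarrow> (real \<Rightarrow> real) \<Rightarrow> bool" where
  "stability_boundary \<mu> a b \<longleftrightarrow>
     (\<exists>\<epsilon>\<^sub>0>0. \<exists>\<delta>>0.
        a 0 = resonance_alpha \<mu> \<and> b 0 = resonance_alpha \<mu> \<and>
        (\<forall>\<epsilon> \<alpha>. 0 < \<epsilon> \<and> \<epsilon> < \<epsilon>\<^sub>0 \<and> \<bar>\<alpha> - resonance_alpha \<mu>\<bar> < \<delta> \<longrightarrow>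
           (\<alpha> \<in> open_segment (a \<epsilon>) (b \<epsilon>) \<longrightarrow> unstable (linearized_H \<mu> \<alpha> \<epsilon>)) \<and>
           (\<alpha> \<notin> closed_segment (a \<epsilon>) (b \<epsilon>) \<longrightarrow> stable (linearized_H \<mu> \<alpha> \<epsilon>))))"

end

theory Submission imports Defs begin

text \<open>
  Write \<open>a = \<alpha> + \<mu>/4\<close> and let \<open>F(a, e) = x(\<pi>)\<close> for the solution of \<open>x'' + (a + e cos t) x = 0\<close>
  with \<open>x(0) = 1\<close>, \<open>x'(0) = 0\<close>. Since the equation is invariant under \<open>t \<mapsto> 2\<pi> - t\<close>, and
  \<open>t \<mapsto> \<pi> - t\<close> changes the sign of \<open>e\<close>, half the trace of the monodromy matrix is
  \<open>2 F(a, e) F(a, -e) - 1\<close>. Near the resonance both factors are small, so the system is stable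
  where they have the same sign and unstable where they have opposite signs. The two boundary
  curves are the zeros of \<open>F(\<cdot>, e)\<close> and \<open>F(\<cdot>, -e)\<close>. All sign information on \<open>F\<close> comes from
  integrating Wronskians over \<open>[0, \<pi>]\<close>: comparing two values of \<open>a\<close> shows that \<open>F\<close> changes sign
  once, and comparing with an explicit trigonometric polynomial that solves the equation up to
  \<open>O(e\<^sup>6)\<close> locates the zero up to \<open>O(e\<^sup>6)\<close>.
\<close>

section \<open>Solutions of linear equations with entire coefficients\<close>

text \<open>Comparison of Taylor coefficients in \<open>x'' = - Q x\<close> with
  \<open>x 0 = c\<close> and \<open>x' 0 = d\<close>.\<close>

fun ode_coeff :: "real fps \<Rightarrow> real \<Rightarrow> real \<Rightarrow> nat \<Rightarrow> real" where
  "ode_coeff Q c d 0 = c"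
| "ode_coeff Q c d (Suc 0) = d"
| "ode_coeff Q c d (Suc (Suc n)) =
     - (\<Sum>i\<le>n. ode_coeff Q c d i * fps_nth Q (n - i)) / (real (n + 1) * real (n + 2))"

text \<open>With \<open>R = 2 * r\<close>, the numbers
  \<open>\<bar>ode_coeff Q c d n\<bar> * R ^ n\<close> stay bounded by induction: one use of the
  recurrence costs at most the factor \<open>S * R\<^sup>2 / ((m + 1) * (m + 2))\<close>, where
  \<open>S\<close> is the absolute sum of the series \<open>Q\<close> at \<open>R\<close>. At
  \<open>r\<close> the series is then dominated by a geometric one of ratio 1/2.\<close>

lemma ode_coeff_radius:
  assumes "fps_conv_radius Q = \<infinity>"
  shows "conv_radius (ode_coeff Q c d) = \<infinity>"
proof -
  let ?f = "ode_coeff Q c d"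
  have "conv_radius ?f \<ge> \<infinity>"
  proof (rule conv_radius_geI_ex')
    fix r :: real assume r: "0 < r"
    define R where "R = 2 * r"
    have R: "R > 0" using r by (simp add: R_def)
    have sQ: "summable (\<lambda>n. \<bar>fps_nth Q n\<bar> * R ^ n)"
      using norm_summable_fps[of R Q] assms R by (simp add: abs_mult)
    define S where "S = (\<Sum>n. \<bar>fps_nth Q n\<bar> * R ^ n)"
    have S: "(\<Sum>i\<le>n. \<bar>fps_nth Q (n - i)\<bar> * R ^ (n - i)) \<le> S" for n
    proof -
      have "(\<Sum>i\<le>n. \<bar>fps_nth Q (n - i)\<bar> * R ^ (n - i)) = (\<Sum>i\<le>n. \<bar>fps_nth Q i\<bar> * R ^ i)"
        by (rule sum.nat_diff_reindex[of "\<lambda>i. \<bar>fps_nth Q i\<bar> * R ^ i" "Suc n",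
              unfolded lessThan_Suc_atMost, simplified])
      also have "\<dots> \<le> S"
        unfolding S_def using sQ R by (intro sum_le_suminf) auto
      finally show ?thesis .
    qed
    \<comment> \<open>From index \<open>N\<close> on the factor of the recurrence is at most 1; the
      sum \<open>C\<close> covers the indices before that.\<close>
    obtain N where N: "real N \<ge> S * R\<^sup>2" using real_arch_simple by blast
    define C where "C = (\<Sum>i\<le>N+2. \<bar>?f i\<bar> * R ^ i)"
    have C0: "C \<ge> 0" unfolding C_def using R by (intro sum_nonneg) auto
    have bound: "\<bar>?f n\<bar> * R ^ n \<le> C" for n
    proof (induction n rule: less_induct)
      case (less n)
      show ?case
      proof (cases "n \<le> N + 2")
        case True
        then show ?thesis unfolding C_def
          using R by (intro member_le_sum) auto
      next
        case False
        then obtain m where m: "n = Suc (Suc m)" "m \<ge> N"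
          by (metis Suc_le_mono add_2_eq_Suc' le_cases not0_implies_Suc not_less_eq_eq zero_le)
        have "\<bar>\<Sum>i\<le>m. ?f i * fps_nth Q (m - i)\<bar> * R ^ m
            \<le> (\<Sum>i\<le>m. \<bar>?f i * fps_nth Q (m - i)\<bar>) * R ^ m"
          using R by (intro mult_right_mono sum_abs) auto
        also have "\<dots> = (\<Sum>i\<le>m. (\<bar>?f i\<bar> * R ^ i) * (\<bar>fps_nth Q (m - i)\<bar> * R ^ (m - i)))"
          unfolding sum_distrib_right
        proof (rule sum.cong)
          fix i assume "i \<in> {..m}"
          then have "R ^ m = R ^ i * R ^ (m - i)" by (simp flip: power_add)
          then show "\<bar>?f i * fps_nth Q (m - i)\<bar> * R ^ m
              = (\<bar>?f i\<bar> * R ^ i) * (\<bar>fps_nth Q (m - i)\<bar> * R ^ (m - i))"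
            by (simp add: abs_mult)
        qed simp
        also have "\<dots> \<le> (\<Sum>i\<le>m. C * (\<bar>fps_nth Q (m - i)\<bar> * R ^ (m - i)))"
          using less m R by (intro sum_mono mult_right_mono) auto
        also have "\<dots> \<le> C * S"
          using S[of m] C0 by (simp add: mult_left_mono flip: sum_distrib_left)
        finally have 1: "\<bar>\<Sum>i\<le>m. ?f i * fps_nth Q (m - i)\<bar> * R ^ m \<le> C * S" .
        have "S * R\<^sup>2 \<le> real m" using N m by linarith
        also have "real m \<le> real (m + 1) * real (m + 2)" by (simp add: algebra_simps)
        finally have 2: "S * R\<^sup>2 \<le> real (m + 1) * real (m + 2)" .
        have "\<bar>?f n\<bar> * R ^ n
            = (\<bar>\<Sum>i\<le>m. ?f i * fps_nth Q (m - i)\<bar> * R ^ m) * R\<^sup>2 / (real (m + 1) * real (m + 2))"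
          by (simp add: m abs_mult power2_eq_square)
        also have "\<dots> \<le> C * S * R\<^sup>2 / (real (m + 1) * real (m + 2))"
          using 1 by (intro divide_right_mono mult_right_mono) auto
        also have "\<dots> \<le> C"
          using 2 C0 mult_left_mono[OF 2 C0] by (simp add: divide_le_eq mult.assoc del: of_nat_add)
        finally show ?thesis .
      qed
    qed
    show "summable (\<lambda>n. ?f n * of_real r ^ n)"
    proof (rule summable_comparison_test')
      show "summable (\<lambda>n. C * (1/2) ^ n)" by (intro summable_mult summable_geometric) auto
      fix n :: nat
      have "\<bar>?f n\<bar> * r ^ n = (\<bar>?f n\<bar> * R ^ n) * (1/2) ^ n"
        by (simp add: R_def power_mult_distrib power_divide)
      also have "\<dots> \<le> C * (1/2) ^ n" using bound[of n] by (intro mult_right_mono) auto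
      finally show "norm (?f n * of_real r ^ n) \<le> C * (1/2) ^ n"
        using r by (simp add: abs_mult)
    qed
  qed
  then show ?thesis by simp
qed

text \<open>The formal power series solution converges everywhere, which yields solutions on the
  whole real line at once.\<close>

lemma power_series_ode_exists:
  assumes Q: "fps_conv_radius Q = \<infinity>"
  shows "\<exists>x y. x 0 = c \<and> y 0 = d \<and>
    (\<forall>t. (x has_real_derivative y t) (at t) \<and>
         (y has_real_derivative - eval_fps Q t * x t) (at t))"
proof -
  define F where "F = Abs_fps (ode_coeff Q c d)"
  have F: "fps_conv_radius F = \<infinity>"
    using ode_coeff_radius[OF Q] by (simp add: fps_conv_radius_def F_def)
  have F': "fps_conv_radius (fps_deriv F) = \<infinity>"
    using fps_conv_radius_deriv[of F] F by simp
  have D: "(eval_fps F has_real_derivative eval_fps (fps_deriv F) t) (at t)" for t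
    using F by (intro derivative_eq_intros has_field_derivative_eval_fps) auto
  have D': "(eval_fps (fps_deriv F) has_real_derivative eval_fps (fps_deriv (fps_deriv F)) t) (at t)" for t
    using F' by (intro derivative_eq_intros has_field_derivative_eval_fps) auto
  have eq: "fps_deriv (fps_deriv F) = - (F * Q)"
  proof (rule fps_ext)
    fix n
    have "fps_nth (fps_deriv (fps_deriv F)) n = real (n+1) * (real (n+2) * ode_coeff Q c d (Suc (Suc n)))"
      by (simp add: F_def)
    also have "\<dots> = - (\<Sum>i\<le>n. ode_coeff Q c d i * fps_nth Q (n - i))"
      unfolding ode_coeff.simps by (simp add: divide_simps del: of_nat_add of_nat_Suc)
    also have "\<dots> = fps_nth (- (F * Q)) n"
      by (simp add: fps_mult_nth F_def atMost_atLeast0)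
    finally show "fps_nth (fps_deriv (fps_deriv F)) n = fps_nth (- (F * Q)) n" .
  qed
  have FQ: "fps_conv_radius (F * Q) = \<infinity>"
    using fps_conv_radius_mult[of F Q] F Q by simp
  have "eval_fps (fps_deriv (fps_deriv F)) t = - eval_fps Q t * eval_fps F t" for t
    using F Q FQ by (simp add: eq eval_fps_minus eval_fps_mult)
  with D D' have "\<forall>t. (eval_fps F has_real_derivative eval_fps (fps_deriv F) t) (at t) \<and>
         (eval_fps (fps_deriv F) has_real_derivative - eval_fps Q t * eval_fps F t) (at t)"
    by simp
  moreover have "eval_fps F 0 = c" "eval_fps (fps_deriv F) 0 = d"
    by (simp_all add: eval_fps_at_0 F_def)
  ultimately show ?thesis by blast
qed

definition mathieu_sol :: "real \<Rightarrow> real \<Rightarrow> (real \<Rightarrow> real) \<Rightarrow> (real \<Rightarrow> real) \<Rightarrow> bool" where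
  "mathieu_sol a e x y \<longleftrightarrow>
     (\<forall>t. (x has_real_derivative y t) (at t) \<and>
          (y has_real_derivative - (e * cos t + a) * x t) (at t))"

lemma mathieu_sol_exists: "\<exists>x y. mathieu_sol a e x y \<and> x 0 = c \<and> y 0 = d"
proof -
  define Q where "Q = fps_const e * fps_cos 1 + fps_const a"
  have ec: "fps_conv_radius (fps_const e * fps_cos (1::real)) = \<infinity>"
    using fps_conv_radius_mult[of "fps_const e" "fps_cos (1::real)"] by simp
  then have "fps_conv_radius Q = \<infinity>"
    using fps_conv_radius_add[of "fps_const e * fps_cos 1" "fps_const a"] by (simp add: Q_def)
  moreover have "eval_fps Q t = e * cos t + a" for t
    using ec by (simp add: Q_def eval_fps_add eval_fps_mult)
  ultimately show ?thesis
    using power_series_ode_exists[of Q c d] unfolding mathieu_sol_def by auto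
qed

section \<open>Monodromy\<close>

text \<open>Three uses: \<open>a = b\<close> and \<open>r = 0\<close> gives a conserved quantity,
  \<open>r = 0\<close> alone compares two parameters, and a general \<open>r\<close> compares with
  an approximate solution.\<close>

lemma wronskian_derivative:
  assumes "mathieu_sol a e x y"
    and "(u has_real_derivative v t) (at t)"
    and "(v has_real_derivative - (e * cos t + b) * u t + r) (at t)"
  shows "((\<lambda>t. x t * v t - y t * u t) has_real_derivative (a - b) * (x t * u t) + x t * r) (at t)"
proof -
  have "(x has_real_derivative y t) (at t)"
    "(y has_real_derivative - (e * cos t + a) * x t) (at t)"
    using assms(1) by (auto simp: mathieu_sol_def)
  from DERIV_diff[OF DERIV_mult[OF this(1) assms(3)] DERIV_mult[OF this(2) assms(2)]]
  show ?thesis by (simp add: algebra_simps)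
qed

lemma wronskian_const:
  assumes "mathieu_sol a e x y" "mathieu_sol a e u v"
  shows "x t * v t - y t * u t = x s * v s - y s * u s"
proof (rule DERIV_isconst_all[where f = "\<lambda>t. x t * v t - y t * u t"])
  show "\<forall>t. ((\<lambda>t. x t * v t - y t * u t) has_real_derivative 0) (at t)"
    using wronskian_derivative[OF assms(1), where b = a and r = 0] assms(2)
    by (simp add: mathieu_sol_def)
qed

text \<open>Applied with \<open>c = 2 * pi\<close>, \<open>e' = e\<close> and with
  \<open>c = pi\<close>, \<open>e' = - e\<close>.\<close>

lemma mathieu_sol_reflect:
  assumes "mathieu_sol a e x y" and "\<And>t. e' * cos t = e * cos (c - t)"
  shows "mathieu_sol a e' (\<lambda>t. x (c - t)) (\<lambda>t. - y (c - t))"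
proof -
  have x: "(x has_real_derivative y s) (at s)"
    and y: "(y has_real_derivative - (e * cos s + a) * x s) (at s)" for s
    using assms(1) by (auto simp: mathieu_sol_def)
  have "((\<lambda>t. x (c - t)) has_real_derivative y (c - t) * (0 - 1)) (at t)" for t
    by (rule DERIV_chain2[OF x]) (intro derivative_intros)
  moreover have "((\<lambda>t. y (c - t)) has_real_derivative - (e * cos (c - t) + a) * x (c - t) * (0 - 1)) (at t)" for t
    by (rule DERIV_chain2[OF y]) (intro derivative_intros)
  note DERIV_minus[OF this]
  ultimately show ?thesis by (simp add: mathieu_sol_def assms(2))
qed

lemma mathieu_sol_shift:
  assumes "mathieu_sol a e x y" and "\<And>t. cos (t + c) = cos t"
  shows "mathieu_sol a e (\<lambda>t. x (t + c)) (\<lambda>t. y (t + c))"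
  unfolding mathieu_sol_def
proof safe
  fix t
  have "(x has_real_derivative y (t + c)) (at (t + c))"
    "(y has_real_derivative - (e * cos t + a) * x (t + c)) (at (t + c))"
    using assms(1) unfolding mathieu_sol_def by (auto simp flip: assms(2)[of t])
  then show "((\<lambda>t. x (t + c)) has_real_derivative y (t + c)) (at t)"
    "((\<lambda>t. y (t + c)) has_real_derivative - (e * cos t + a) * x (t + c)) (at t)"
    by (simp_all only: DERIV_shift)
qed

lemma mathieu_sol_linear:
  assumes "mathieu_sol a e x y" "mathieu_sol a e u v"
  shows "mathieu_sol a e (\<lambda>t. p * x t + q * u t) (\<lambda>t. p * y t + q * v t)"
  using assms unfolding mathieu_sol_def
  by (auto intro!: derivative_eq_intros simp: algebra_simps)

locale mathieu_fundamental =
  fixes a e :: real and x1 y1 x2 y2 :: "real \<Rightarrow> real"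
  assumes sol1: "mathieu_sol a e x1 y1" "x1 0 = 1" "y1 0 = 0"
    and sol2: "mathieu_sol a e x2 y2" "x2 0 = 0" "y2 0 = 1"
begin

lemma wronskian_eq_1: "x1 t * y2 t - y1 t * x2 t = 1"
  using wronskian_const[OF sol1(1) sol2(1), of t 0] sol1 sol2 by simp

text \<open>The constant Wronskians with the two basis solutions are linear equations for
  \<open>x t\<close> and \<open>y t\<close> with determinant 1.\<close>

lemma sol_expand:
  assumes "mathieu_sol a e x y"
  shows "x t = x 0 * x1 t + y 0 * x2 t" "y t = x 0 * y1 t + y 0 * y2 t"
proof -
  have "x t * y1 t - y t * x1 t = - y 0" "x t * y2 t - y t * x2 t = x 0"
    using wronskian_const[OF assms sol1(1), of t 0] wronskian_const[OF assms sol2(1), of t 0]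
      sol1 sol2 by simp_all
  with wronskian_eq_1[of t] show "x t = x 0 * x1 t + y 0 * x2 t" "y t = x 0 * y1 t + y 0 * y2 t"
    by algebra+
qed

text \<open>The monodromy matrix over one period has rows \<open>(m, k)\<close> and
  \<open>(l, m)\<close>, as \<open>monodromy\<close> shows.\<close>

definition k where "k = 2 * x2 pi * y2 pi"
definition l where "l = 2 * x1 pi * y1 pi"
definition m where "m = x1 pi * y2 pi + y1 pi * x2 pi"

lemma m_eq: "m = 2 * (x1 pi * y2 pi) - 1"
  using wronskian_eq_1[of pi] by (simp add: m_def)

lemma m_sq: "m\<^sup>2 - k * l = 1"
proof -
  have "m\<^sup>2 - k * l = (x1 pi * y2 pi - y1 pi * x2 pi)\<^sup>2"
    by (simp add: m_def k_def l_def algebra_simps power2_eq_square)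
  then show ?thesis by (simp add: wronskian_eq_1)
qed

text \<open>Reflection about \<open>\<pi>\<close> expresses the monodromy through the values at \<open>\<pi>\<close>.\<close>

lemma monodromy:
  assumes "mathieu_sol a e x y"
  shows "x (2 * pi) = m * x 0 + k * y 0" "y (2 * pi) = l * x 0 + m * y 0"
proof -
  have r: "mathieu_sol a e (\<lambda>t. u (2 * pi - t)) (\<lambda>t. - v (2 * pi - t))"
    if "mathieu_sol a e u v" for u v
    using that by (rule mathieu_sol_reflect) simp
  have "x1 pi = x1 (2*pi) * x1 pi - y1 (2*pi) * x2 pi"
    \<comment> \<open>A reflected solution has initial data read off at \<open>2 * pi\<close>, and
      at \<open>pi\<close> it agrees with the original up to the sign of the derivative. These four
      equations determine the values at \<open>2 * pi\<close>.\<close>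
    "- y1 pi = x1 (2*pi) * y1 pi - y1 (2*pi) * y2 pi"
    "x2 pi = x2 (2*pi) * x1 pi - y2 (2*pi) * x2 pi"
    "- y2 pi = x2 (2*pi) * y1 pi - y2 (2*pi) * y2 pi"
    using sol_expand[OF r[OF sol1(1)], of pi] sol_expand[OF r[OF sol2(1)], of pi] by simp_all
  then have "x1 (2*pi) = m" "y1 (2*pi) = l" "x2 (2*pi) = k" "y2 (2*pi) = m"
    using wronskian_eq_1[of pi] unfolding m_def k_def l_def by algebra+
  then show "x (2 * pi) = m * x 0 + k * y 0" "y (2 * pi) = l * x 0 + m * y 0"
    using sol_expand[OF assms, of "2 * pi"] by (simp_all add: mult.commute)
qed

lemma monodromy_at:
  assumes "mathieu_sol a e x y" "\<And>t. cos (t + s) = cos t"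
  shows "x (s + 2 * pi) = m * x s + k * y s" "y (s + 2 * pi) = l * x s + m * y s"
  using monodromy[OF mathieu_sol_shift[OF assms]] by (simp_all add: add.commute)

text \<open>The monodromy matrix has equal diagonal entries \<open>m\<close>, so it preserves the quadratic form
  \<open>l x\<^sup>2 - k y\<^sup>2\<close>.\<close>

lemma invariant_form:
  assumes "mathieu_sol a e x y"
  shows "l * (x (2 * pi * of_int n))\<^sup>2 - k * (y (2 * pi * of_int n))\<^sup>2 = l * (x 0)\<^sup>2 - k * (y 0)\<^sup>2"
    (is "?Q n = _")
proof -
  have per: "cos (t + 2 * pi * of_int n) = cos t" for t and n :: int
    by (simp add: cos_add)
  have step: "?Q (n + 1) = ?Q n" for n
  proof -
    have "2 * pi * of_int (n + 1) = 2 * pi * of_int n + 2 * pi" by (simp add: algebra_simps)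
    with monodromy_at[OF assms per, of n] m_sq show ?thesis by (simp only:) algebra
  qed
  have "?Q n = ?Q 0"
  proof (induction n rule: int_induct[where k = 0])
    case (step2 i)
    then show ?case using step[of "i - 1"] by simp
  qed (use step in simp_all)
  then show ?thesis by simp
qed

section \<open>Boundedness and growth of solutions\<close>

text \<open>Here \<open>\<bar>m\<bar> < 1\<close>, so \<open>k * l < 0\<close> and the invariant
  form is definite. This bounds the solution at all multiples of \<open>2 * pi\<close>; between them
  the basis solutions are bounded by compactness.\<close>

lemma sol_bounded:
  assumes "0 < x1 pi * y2 pi" "x1 pi * y2 pi < 1" and xy: "mathieu_sol a e x y"
  shows "bounded (range (\<lambda>t. (x t, y t)))"
proof -
  have "m\<^sup>2 < 1" using assms by (simp add: m_eq abs_square_less_1)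
  then have kl: "k * l < 0" using m_sq by simp
  define M where "M = \<bar>l * (x 0)\<^sup>2 - k * (y 0)\<^sup>2\<bar>"
  have form: "\<bar>l\<bar> * u\<^sup>2 + \<bar>k\<bar> * v\<^sup>2 = \<bar>l * u\<^sup>2 - k * v\<^sup>2\<bar>" for u v
  proof (cases "l > 0")
    case True
    then have "k < 0" "l * u\<^sup>2 \<ge> 0" using kl by (auto simp: mult_less_0_iff)
    moreover from this have "k * v\<^sup>2 \<le> 0" by (simp add: mult_nonpos_nonneg)
    ultimately show ?thesis using True by (simp only: abs_of_pos abs_of_neg)
  next
    case False
    then have "k > 0" "l < 0" "l * u\<^sup>2 \<le> 0" using kl by (auto simp: mult_less_0_iff mult_nonpos_nonneg)
    moreover from this have "k * v\<^sup>2 \<ge> 0" by simp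
    ultimately show ?thesis by (simp only: abs_of_pos abs_of_neg)
  qed
  define B where "B = sqrt (M / \<bar>l\<bar>) + sqrt (M / \<bar>k\<bar>)"
  have M0: "M \<ge> 0" by (simp add: M_def)
  have kl0: "\<bar>k\<bar> > 0" "\<bar>l\<bar> > 0" using kl by auto
  have xn: "\<bar>x (2 * pi * of_int n)\<bar> \<le> B" and yn: "\<bar>y (2 * pi * of_int n)\<bar> \<le> B" for n
  proof -
    let ?u = "x (2 * pi * of_int n)" and ?v = "y (2 * pi * of_int n)"
    have "\<bar>l\<bar> * ?u\<^sup>2 + \<bar>k\<bar> * ?v\<^sup>2 = M"
      unfolding form invariant_form[OF xy] M_def ..
    then have "\<bar>l\<bar> * ?u\<^sup>2 \<le> M" "\<bar>k\<bar> * ?v\<^sup>2 \<le> M"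
      using zero_le_power2[of ?u] zero_le_power2[of ?v] by (smt (verit) mult_nonneg_nonneg abs_ge_zero)+
    then have "?u\<^sup>2 \<le> M / \<bar>l\<bar>" "?v\<^sup>2 \<le> M / \<bar>k\<bar>" using kl0 by (simp_all add: field_simps)
    then have "\<bar>?u\<bar> \<le> sqrt (M / \<bar>l\<bar>)" "\<bar>?v\<bar> \<le> sqrt (M / \<bar>k\<bar>)" by (auto intro: real_le_rsqrt)
    moreover have "sqrt (M / \<bar>l\<bar>) \<ge> 0" "sqrt (M / \<bar>k\<bar>) \<ge> 0" using M0 by simp_all
    ultimately show "\<bar>?u\<bar> \<le> B" "\<bar>?v\<bar> \<le> B" unfolding B_def by linarith+
  qed
  have "continuous_on {0..2*pi} (\<lambda>s. \<bar>x1 s\<bar> + \<bar>y1 s\<bar> + \<bar>x2 s\<bar> + \<bar>y2 s\<bar>)"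
    using sol1(1) sol2(1) unfolding mathieu_sol_def
    by (intro continuous_intros DERIV_continuous_on[of "{0..2*pi}"]) (auto intro: has_field_derivative_at_within)
  then have "bounded ((\<lambda>s. \<bar>x1 s\<bar> + \<bar>y1 s\<bar> + \<bar>x2 s\<bar> + \<bar>y2 s\<bar>) ` {0..2*pi})"
    by (intro compact_imp_bounded compact_continuous_image) auto
  then obtain K where "\<forall>s\<in>{0..2*pi}. norm (\<bar>x1 s\<bar> + \<bar>y1 s\<bar> + \<bar>x2 s\<bar> + \<bar>y2 s\<bar>) \<le> K"
    by (auto simp: bounded_iff)
  then have K: "\<bar>x1 s\<bar> + \<bar>y1 s\<bar> + \<bar>x2 s\<bar> + \<bar>y2 s\<bar> \<le> K" if "0 \<le> s" "s \<le> 2*pi" for s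
    using that by force
  have B0: "B \<ge> 0" using xn[of 0] by linarith
  have "norm (x t, y t) \<le> B * K + B * K" for t
  proof -
    define n where "n = \<lfloor>t / (2*pi)\<rfloor>"
    define s where "s = t - 2*pi * of_int n"
    have "of_int n \<le> t / (2*pi)" "t / (2*pi) < of_int n + 1" unfolding n_def by linarith+
    then have s: "0 \<le> s" "s \<le> 2*pi" by (simp_all add: s_def field_simps)
    have "mathieu_sol a e (\<lambda>t. x (t + 2*pi * of_int n)) (\<lambda>t. y (t + 2*pi * of_int n))"
      by (rule mathieu_sol_shift[OF xy]) (simp add: cos_add)
    from sol_expand[OF this, of s]
    have eq: "x t = x (2*pi * of_int n) * x1 s + y (2*pi * of_int n) * x2 s"
      "y t = x (2*pi * of_int n) * y1 s + y (2*pi * of_int n) * y2 s"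
      by (simp_all add: s_def)
    have K': "\<bar>x1 s\<bar> + \<bar>x2 s\<bar> \<le> K" "\<bar>y1 s\<bar> + \<bar>y2 s\<bar> \<le> K"
      using K[OF s] abs_ge_zero[of "x1 s"] abs_ge_zero[of "x2 s"] abs_ge_zero[of "y1 s"]
        abs_ge_zero[of "y2 s"] by linarith+
    have "\<bar>p * f + q * g\<bar> \<le> B * (\<bar>f\<bar> + \<bar>g\<bar>)" if "\<bar>p\<bar> \<le> B" "\<bar>q\<bar> \<le> B" for p q f g
      using that mult_right_mono[OF that(1), of "\<bar>f\<bar>"] mult_right_mono[OF that(2), of "\<bar>g\<bar>"]
        abs_triangle_ineq[of "p * f" "q * g"] by (simp add: abs_mult algebra_simps)
    note b = this[OF xn[of n] yn[of n]]
    have "\<bar>x t\<bar> \<le> B * K"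
      unfolding eq by (rule order_trans[OF b mult_left_mono[OF K'(1) B0]])
    moreover have "\<bar>y t\<bar> \<le> B * K"
      unfolding eq by (rule order_trans[OF b mult_left_mono[OF K'(2) B0]])
    ultimately show ?thesis using norm_Pair_le[of "x t" "y t"] by simp
  qed
  then show ?thesis unfolding bounded_iff by blast
qed

text \<open>Here \<open>m < -1\<close>, and the vector \<open>(k, - s)\<close> with
  \<open>s\<^sup>2 = m\<^sup>2 - 1 = k * l\<close> is an eigenvector of the monodromy matrix for the
  eigenvalue \<open>m - s\<close>, whose modulus exceeds 1. The solution starting there grows
  geometrically along the periods.\<close>

lemma exists_unbounded_sol:
  assumes "x1 pi * y2 pi < 0"
  shows "\<exists>x y. mathieu_sol a e x y \<and> \<not> bounded (range (\<lambda>t. (x t, y t)))"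
proof -
  have m: "m < -1" using assms by (simp add: m_eq)
  define s where "s = sqrt (m\<^sup>2 - 1)"
  define \<mu> where "\<mu> = m - s"
  have "m\<^sup>2 > 1" using m power_strict_mono[of 1 "- m" 2] by simp
  then have s: "s > 0" and s2: "s\<^sup>2 = k * l" using m_sq by (simp_all add: s_def)
  have k: "k \<noteq> 0" using s s2 by auto
  have \<mu>: "\<bar>\<mu>\<bar> > 1" using m s by (simp add: \<mu>_def)
  define x where "x = (\<lambda>t. k * x1 t + (- s) * x2 t)"
  define y where "y = (\<lambda>t. k * y1 t + (- s) * y2 t)"
  have sol: "mathieu_sol a e x y"
    unfolding x_def y_def by (rule mathieu_sol_linear[OF sol1(1) sol2(1)])
  have iter: "x (2 * pi * real n) = \<mu> ^ n * k \<and> y (2 * pi * real n) = - (\<mu> ^ n * s)" for n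
  proof (induction n)
    case 0
    then show ?case by (simp add: x_def y_def sol1 sol2)
  next
    case (Suc n)
    have per: "cos (t + 2 * pi * real n) = cos t" for t
      using cos_int_2pin[of "int n"] sin_int_2pin[of "int n"] by (simp add: cos_add)
    have "2 * pi * real (Suc n) = 2 * pi * real n + 2 * pi" by (simp add: algebra_simps)
    moreover have "m * (\<mu> ^ n * k) + k * (- (\<mu> ^ n * s)) = \<mu> ^ Suc n * k"
      by (simp add: \<mu>_def algebra_simps)
    moreover have "l * (\<mu> ^ n * k) + m * (- (\<mu> ^ n * s)) = - (\<mu> ^ Suc n * s)"
    proof -
      have "l * (\<mu> ^ n * k) + m * (- (\<mu> ^ n * s)) = \<mu> ^ n * (s\<^sup>2 - m * s)"
        unfolding s2 by (simp add: algebra_simps)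
      then show ?thesis by (simp add: \<mu>_def algebra_simps power2_eq_square)
    qed
    ultimately show ?case using monodromy_at[OF sol per] Suc.IH by (simp only:)
  qed
  have "\<not> bounded (range (\<lambda>t. (x t, y t)))"
  proof
    assume "bounded (range (\<lambda>t. (x t, y t)))"
    then obtain M where M: "norm (x t, y t) \<le> M" for t unfolding bounded_iff by blast
    obtain n where "M / \<bar>k\<bar> < \<bar>\<mu>\<bar> ^ n" using real_arch_pow[OF \<mu>] by blast
    then have "M < \<bar>x (2 * pi * real n)\<bar>"
      using k iter[of n] by (simp add: field_simps abs_mult power_abs)
    also have "\<dots> \<le> norm (x (2 * pi * real n), y (2 * pi * real n))"
      using norm_fst_le[of "x (2 * pi * real n)" "y (2 * pi * real n)"] by simp
    finally show False using M[of "2 * pi * real n"] by linarith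
  qed
  with sol show ?thesis by blast
qed

end

section \<open>Solutions near the resonance\<close>

text \<open>The substitution \<open>t \<mapsto> \<pi> - t\<close> changes the sign of \<open>e\<close>, so the odd solution needs no
  separate treatment.\<close>

lemma (in mathieu_fundamental) y2_pi_eq:
  assumes "mathieu_sol a (- e) u v" "u 0 = 1" "v 0 = 0"
  shows "y2 pi = u pi"
proof -
  have "mathieu_sol a e (\<lambda>t. u (pi - t)) (\<lambda>t. - v (pi - t))"
    by (rule mathieu_sol_reflect[OF assms(1)]) simp
  from wronskian_const[OF sol2(1) this, of pi 0] show ?thesis
    by (simp add: assms sol2)
qed

text \<open>The choice turns the even solution into a function of the parameters;
  \<open>mathieu_cosE\<close> recovers its properties.\<close>

definition mathieu_cos :: "real \<Rightarrow> real \<Rightarrow> real \<Rightarrow> real" where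
  "mathieu_cos a e = (SOME x. \<exists>y. mathieu_sol a e x y \<and> x 0 = 1 \<and> y 0 = 0)"

lemma mathieu_cosE:
  obtains y where "mathieu_sol a e (mathieu_cos a e) y" "mathieu_cos a e 0 = 1" "y 0 = 0"
  using someI_ex[OF mathieu_sol_exists[of a e 1 0]] unfolding mathieu_cos_def by blast

definition mathieu_cos_pi :: "real \<Rightarrow> real \<Rightarrow> real" where
  "mathieu_cos_pi a e = mathieu_cos a e pi"

lemma mathieu_fundamental_exists:
  "\<exists>x1 y1 x2 y2. mathieu_fundamental a e x1 y1 x2 y2 \<and>
     x1 pi = mathieu_cos_pi a e \<and> y2 pi = mathieu_cos_pi a (- e)"
proof -
  obtain y1 where 1: "mathieu_sol a e (mathieu_cos a e) y1" "mathieu_cos a e 0 = 1" "y1 0 = 0"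
    by (rule mathieu_cosE)
  obtain v where 2: "mathieu_sol a (- e) (mathieu_cos a (- e)) v" "mathieu_cos a (- e) 0 = 1" "v 0 = 0"
    by (rule mathieu_cosE)
  obtain x2 y2 where 3: "mathieu_sol a e x2 y2" "x2 0 = 0" "y2 0 = 1"
    using mathieu_sol_exists by blast
  have "mathieu_fundamental a e (mathieu_cos a e) y1 x2 y2"
    by unfold_locales (fact 1 3)+
  moreover from this have "y2 pi = mathieu_cos_pi a (- e)"
    unfolding mathieu_cos_pi_def by (rule mathieu_fundamental.y2_pi_eq[OF _ 2])
  ultimately show ?thesis by (auto simp: mathieu_cos_pi_def)
qed

lemma hamiltonian_solution_iff_mathieu_sol:
  "hamiltonian_solution (linearized_H \<mu> \<alpha> e) x y \<longleftrightarrow> mathieu_sol (\<alpha> + \<mu> / 4) e x y"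
  by (simp add: hamiltonian_solution_linearized_H_iff mathieu_sol_def add.assoc)

lemma stable_if_mathieu_cos_pi:
  assumes "0 < mathieu_cos_pi (\<alpha> + \<mu> / 4) e * mathieu_cos_pi (\<alpha> + \<mu> / 4) (- e)"
    "mathieu_cos_pi (\<alpha> + \<mu> / 4) e * mathieu_cos_pi (\<alpha> + \<mu> / 4) (- e) < 1"
  shows "stable (linearized_H \<mu> \<alpha> e)"
  unfolding stable_def hamiltonian_solution_iff_mathieu_sol
  using mathieu_fundamental_exists[of "\<alpha> + \<mu> / 4" e] mathieu_fundamental.sol_bounded assms by metis

lemma unstable_if_mathieu_cos_pi:
  assumes "mathieu_cos_pi (\<alpha> + \<mu> / 4) e * mathieu_cos_pi (\<alpha> + \<mu> / 4) (- e) < 0"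
  shows "unstable (linearized_H \<mu> \<alpha> e)"
  unfolding stable_def hamiltonian_solution_iff_mathieu_sol
  using mathieu_fundamental_exists[of "\<alpha> + \<mu> / 4" e] mathieu_fundamental.exists_unbounded_sol assms by metis

section \<open>A priori estimates on \<open>[0, pi]\<close>\<close>

lemma abs_increment_le:
  fixes f :: "real \<Rightarrow> real"
  assumes "0 \<le> t" and "\<And>s. 0 \<le> s \<Longrightarrow> s \<le> t \<Longrightarrow> (f has_real_derivative f' s) (at s)"
    and "\<And>s. 0 \<le> s \<Longrightarrow> s \<le> t \<Longrightarrow> \<bar>f' s\<bar> \<le> B"
  shows "\<bar>f t - f 0\<bar> \<le> B * t"
proof (cases "t = 0")
  case False
  then obtain z where "0 < z" "z < t" "f t - f 0 = (t - 0) * f' z"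
    using MVT2[of 0 t f f'] assms by force
  then show ?thesis using assms(1) assms(3)[of z] by (simp add: abs_mult mult.commute mult_left_mono)
qed simp

text \<open>The energy \<open>E\<close> is conserved by the unperturbed equation
  \<open>x'' = - x/4\<close>. The perturbation \<open>g\<close> gives \<open>E' \<le> E/200\<close>,
  so by Gronwall \<open>E\<close> stays below \<open>exp (t/200)\<close>, hence below 4.\<close>

lemma mathieu_sol_abs_le_2:
  assumes sol: "mathieu_sol a e x y" and init: "x 0 = 1" "y 0 = 0"
    and near: "\<bar>a - 1/4\<bar> + \<bar>e\<bar> \<le> 1/400" and t: "0 \<le> t" "t \<le> pi"
  shows "\<bar>x t\<bar> \<le> 2"
proof -
  define E where "E s = (x s)\<^sup>2 + 4 * (y s)\<^sup>2" for s
  define g where "g s = e * cos s + (a - 1/4)" for s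
  have g: "\<bar>g s\<bar> \<le> 1/400" for s
    using near abs_triangle_ineq[of "e * cos s" "a - 1/4"]
      mult_left_mono[OF abs_cos_le_one[of s] abs_ge_zero[of e]] by (simp add: g_def abs_mult)
  have E: "(E has_real_derivative - 8 * g s * (x s * y s)) (at s)" for s
    using sol unfolding mathieu_sol_def E_def g_def
    by (auto intro!: derivative_eq_intros simp: algebra_simps power2_eq_square)
  have Ed: "- 8 * g s * (x s * y s) \<le> 1/200 * E s" for s
  proof -
    have "4 * \<bar>x s * y s\<bar> \<le> E s"
      using zero_le_power2[of "\<bar>x s\<bar> - 2 * \<bar>y s\<bar>"]
      by (simp add: E_def power2_diff power_mult_distrib abs_mult)
    moreover have "- 8 * g s * (x s * y s) \<le> 8 * (\<bar>g s\<bar> * \<bar>x s * y s\<bar>)"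
      using abs_ge_minus_self[of "g s * (x s * y s)"] by (simp add: abs_mult)
    moreover have "\<bar>g s\<bar> * \<bar>x s * y s\<bar> \<le> 1/400 * \<bar>x s * y s\<bar>"
      using g by (intro mult_right_mono) auto
    ultimately show ?thesis by linarith
  qed
  have "E t * exp (- (t/200)) \<le> E 0 * exp (- (0/200))"
  proof (rule DERIV_nonpos_imp_nonincreasing[OF t(1)], intro exI conjI)
    fix s
    show "((\<lambda>s. E s * exp (- (s/200))) has_real_derivative
        (- 8 * g s * (x s * y s) - 1/200 * E s) * exp (- (s/200))) (at s)"
      by (auto intro!: derivative_eq_intros E simp: algebra_simps)
    show "(- 8 * g s * (x s * y s) - 1/200 * E s) * exp (- (s/200)) \<le> 0"
      using Ed[of s] by (intro mult_nonpos_nonneg) auto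
  qed
  then have "E t \<le> exp (t/200)" by (simp add: E_def init exp_minus field_simps)
  also have "\<dots> \<le> exp 1" using t pi_less_4 by simp
  also have "\<dots> \<le> 4" using exp_le by linarith
  finally have "(x t)\<^sup>2 + 4 * (y t)\<^sup>2 \<le> 4" by (simp only: E_def)
  then have "(x t)\<^sup>2 \<le> 4" using zero_le_power2[of "y t"] by linarith
  then show ?thesis using abs_le_square_iff[of "x t" 2] by simp
qed

text \<open>Variation of constants: \<open>p\<close> and \<open>q\<close> are constant along the
  unperturbed equation and equal 1 and 0 for \<open>cos (t/2)\<close>. Their derivatives are at most
  1/100 in modulus, so over a length below 4 they move by at most 1/25.\<close>

lemma mathieu_sol_near_resonance:
  assumes sol: "mathieu_sol a e x y" and init: "x 0 = 1" "y 0 = 0"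
    and near: "\<bar>a - 1/4\<bar> + \<bar>e\<bar> \<le> 1/400" and t: "0 \<le> t" "t \<le> pi"
  shows "\<bar>x t - cos (t/2)\<bar> \<le> 1/10" "\<bar>y t + sin (t/2) / 2\<bar> \<le> 1/20"
proof -
  define g where "g s = e * cos s + (a - 1/4)" for s
  have g: "\<bar>g s\<bar> \<le> 1/400" for s
    using near abs_triangle_ineq[of "e * cos s" "a - 1/4"]
      mult_left_mono[OF abs_cos_le_one[of s] abs_ge_zero[of e]] by (simp add: g_def abs_mult)
  define p where "p s = x s * cos (s/2) - 2 * y s * sin (s/2)" for s
  define q where "q s = x s * sin (s/2) + 2 * y s * cos (s/2)" for s
  have p: "(p has_real_derivative 2 * (g s * x s) * sin (s/2)) (at s)" for s
    using sol unfolding mathieu_sol_def p_def g_def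
    by (auto intro!: derivative_eq_intros simp: algebra_simps)
  have q: "(q has_real_derivative 2 * (g s * x s) * (- cos (s/2))) (at s)" for s
    using sol unfolding mathieu_sol_def q_def g_def
    by (auto intro!: derivative_eq_intros simp: algebra_simps)
  have gx: "\<bar>g s * x s\<bar> \<le> 1/200" if "0 \<le> s" "s \<le> t" for s
  proof -
    have "\<bar>x s\<bar> \<le> 2" using mathieu_sol_abs_le_2[OF sol init near] that t by simp
    then show ?thesis using mult_mono[OF g[of s], of "\<bar>x s\<bar>" 2] by (simp add: abs_mult)
  qed
  have b: "\<bar>2 * (g s * x s) * c\<bar> \<le> 1/100" if "0 \<le> s" "s \<le> t" "\<bar>c\<bar> \<le> 1" for s c
    using mult_mono[OF gx[OF that(1,2)] that(3)] by (simp add: abs_mult)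
  have "\<bar>p t - p 0\<bar> \<le> 1/100 * t"
    using t b by (intro abs_increment_le[OF t(1) p]) auto
  then have 1: "\<bar>p t - 1\<bar> \<le> 1/25" using t pi_less_4 by (simp add: p_def init)
  have "\<bar>q t - q 0\<bar> \<le> 1/100 * t"
    using t b by (intro abs_increment_le[OF t(1) q]) auto
  then have 2: "\<bar>q t\<bar> \<le> 1/25" using t pi_less_4 by (simp add: q_def init)
  have sc: "(sin (t/2))\<^sup>2 + (cos (t/2))\<^sup>2 = 1" by simp
  have m: "\<bar>r * c\<bar> \<le> 1/25" if "\<bar>r\<bar> \<le> 1/25" "\<bar>c\<bar> \<le> 1" for r c :: real
    using mult_mono[OF that] by (simp add: abs_mult)
  have "x t - cos (t/2) = (p t - 1) * cos (t/2) + q t * sin (t/2)"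
    unfolding p_def q_def using sc by algebra
  then show "\<bar>x t - cos (t/2)\<bar> \<le> 1/10"
    using m[OF 1 abs_cos_le_one[of "t/2"]] m[OF 2 abs_sin_le_one[of "t/2"]] by linarith
  define z where "z = y t + sin (t/2) / 2"
  have "2 * z = q t * cos (t/2) - (p t - 1) * sin (t/2)"
    unfolding z_def p_def q_def using sc by algebra
  then have "\<bar>2 * z\<bar> \<le> \<bar>q t * cos (t/2)\<bar> + \<bar>(p t - 1) * sin (t/2)\<bar>"
    by (simp only: abs_triangle_ineq4)
  also have "\<dots> \<le> 1/25 + 1/25"
    by (intro add_mono m 1 2 abs_sin_le_one abs_cos_le_one)
  finally have "\<bar>z\<bar> \<le> 1/20" by linarith
  then show "\<bar>y t + sin (t/2) / 2\<bar> \<le> 1/20" by (simp only: z_def)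
qed

text \<open>The products \<open>x u\<close> below are close to \<open>cos\<^sup>2 (t/2) = (1 + cos t)/2\<close>.\<close>

lemma wronskian_increasing:
  fixes x u r W :: "real \<Rightarrow> real"
  assumes W: "\<And>t. 0 \<le> t \<Longrightarrow> t \<le> pi \<Longrightarrow>
      (W has_real_derivative \<theta> * (x t * u t) + x t * r t) (at t)"
    and x: "\<And>t. 0 \<le> t \<Longrightarrow> t \<le> pi \<Longrightarrow> \<bar>x t - cos (t/2)\<bar> \<le> 1/10"
    and u: "\<And>t. 0 \<le> t \<Longrightarrow> t \<le> pi \<Longrightarrow> \<bar>u t - cos (t/2)\<bar> \<le> 1/10"
    and r: "\<And>t. 0 \<le> t \<Longrightarrow> t \<le> pi \<Longrightarrow> \<bar>r t\<bar> \<le> \<rho>"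
    and \<theta>: "8 * \<rho> < \<theta>"
  shows "W 0 < W pi"
proof -
  \<comment> \<open>The error terms in \<open>x t * u t\<close> total at most 21/100, which is below
    1/4, so the product is at least \<open>1/4 + cos t / 2\<close>, with antiderivative
    \<open>t/4 + sin t / 2\<close>. The residual term is at most \<open>2 * \<rho>\<close>.
    Integrated over \<open>[0, pi]\<close> this gives a gain of at least
    \<open>\<theta> * pi / 4 - 2 * \<rho> * pi\<close>, whence the factor 8.\<close>
  let ?V = "\<lambda>t. W t - \<theta> * (t/4 + sin t / 2) + 2 * \<rho> * t"
  have \<rho>: "0 \<le> \<rho>" using r[of 0] by (meson abs_ge_zero order_trans pi_ge_zero order_refl)
  have "?V 0 \<le> ?V pi"
  proof (rule DERIV_nonneg_imp_nondecreasing[OF pi_ge_zero], intro exI conjI)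
    fix t :: real assume t: "0 \<le> t" "t \<le> pi"
    show "(?V has_real_derivative (\<theta> * (x t * u t) + x t * r t) - \<theta> * (1/4 + cos t / 2) + 2 * \<rho>) (at t)"
      by (auto intro!: derivative_eq_intros W[OF t] simp: algebra_simps)
    define c where "c = cos (t/2)"
    define d where "d = x t - c"
    define d' where "d' = u t - c"
    have d: "\<bar>d\<bar> \<le> 1/10" "\<bar>d'\<bar> \<le> 1/10" "\<bar>c\<bar> \<le> 1"
      using x[OF t] u[OF t] by (simp_all add: d_def d'_def c_def)
    have cos: "cos t = 2 * c\<^sup>2 - 1" using cos_double_cos[of "t/2"] by (simp add: c_def)
    have "\<bar>c * d\<bar> \<le> 1/10" "\<bar>c * d'\<bar> \<le> 1/10" "\<bar>d * d'\<bar> \<le> 1/100"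
      using mult_mono[OF d(3,1)] mult_mono[OF d(3,2)] mult_mono[OF d(1,2)] by (simp_all add: abs_mult)
    moreover have "x t * u t = c\<^sup>2 + c * d + c * d' + d * d'"
      by (simp add: d_def d'_def algebra_simps power2_eq_square)
    ultimately have "x t * u t \<ge> 1/4 + cos t / 2" using cos by linarith
    then have "\<theta> * (x t * u t) \<ge> \<theta> * (1/4 + cos t / 2)"
      using \<theta> \<rho> by (intro mult_left_mono) auto
    moreover have "\<bar>x t\<bar> \<le> 2" using d unfolding d_def by linarith
    then have "\<bar>x t * r t\<bar> \<le> 2 * \<rho>"
      using mult_mono[OF _ r[OF t], of "x t" 2] unfolding abs_mult by (intro mult_mono r[OF t]) auto
    ultimately show "0 \<le> (\<theta> * (x t * u t) + x t * r t) - \<theta> * (1/4 + cos t / 2) + 2 * \<rho>"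
      by linarith
  qed
  then have "W 0 \<le> W pi - (\<theta> * pi) / 4 + 2 * (\<rho> * pi)" by simp
  moreover have "8 * \<rho> * pi < \<theta> * pi" using \<theta> by (intro mult_strict_right_mono) auto
  ultimately show ?thesis by linarith
qed

section \<open>The sign of \<open>mathieu_cos_pi\<close> as \<open>a\<close> varies\<close>

lemma mathieu_cos_pi_abs_le:
  assumes "\<bar>a - 1/4\<bar> + \<bar>e\<bar> \<le> 1/400"
  shows "\<bar>mathieu_cos_pi a e\<bar> \<le> 1/10"
proof -
  obtain y where y: "mathieu_sol a e (mathieu_cos a e) y" "mathieu_cos a e 0 = 1" "y 0 = 0"
    by (rule mathieu_cosE)
  show ?thesis
    using mathieu_sol_near_resonance(1)[OF y assms, of pi] by (simp add: mathieu_cos_pi_def)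
qed

text \<open>A Sturm comparison: the Wronskian vanishes at 0, and its growth gives
  \<open>x pi * v pi < y pi * u pi\<close>. Both derivatives at \<open>pi\<close> are near -1/2, so
  a nonpositive \<open>x pi\<close> forces a negative \<open>u pi\<close>.\<close>

lemma mathieu_cos_pi_neg_mono:
  assumes a: "\<bar>a - 1/4\<bar> + \<bar>e\<bar> \<le> 1/400" and b: "\<bar>b - 1/4\<bar> + \<bar>e\<bar> \<le> 1/400"
    and "a < b" "mathieu_cos_pi a e \<le> 0"
  shows "mathieu_cos_pi b e < 0"
proof -
  let ?x = "mathieu_cos a e" and ?u = "mathieu_cos b e"
  obtain y where y: "mathieu_sol a e ?x y" "?x 0 = 1" "y 0 = 0" by (rule mathieu_cosE)
  obtain v where v: "mathieu_sol b e ?u v" "?u 0 = 1" "v 0 = 0" by (rule mathieu_cosE)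
  have W: "((\<lambda>t. ?x t * v t - y t * ?u t) has_real_derivative (a - b) * (?x t * ?u t)) (at t)" for t
    using wronskian_derivative[OF y(1), of ?u v t b 0] v(1) by (simp add: mathieu_sol_def)
  have "- (?x 0 * v 0 - y 0 * ?u 0) < - (?x pi * v pi - y pi * ?u pi)"
  proof (rule wronskian_increasing[where \<theta> = "b - a" and r = "\<lambda>_. 0" and \<rho> = 0])
    show "((\<lambda>t. - (?x t * v t - y t * ?u t)) has_real_derivative
        (b - a) * (?x t * ?u t) + ?x t * 0) (at t)" for t
      using DERIV_minus[OF W[of t]] by (simp add: algebra_simps)
  qed (use mathieu_sol_near_resonance(1)[OF y a] mathieu_sol_near_resonance(1)[OF v b] \<open>a < b\<close> in auto)
  then have lt: "?x pi * v pi < y pi * ?u pi" by (simp add: y v)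
  have neg: "y pi < 0" "v pi < 0"
    using mathieu_sol_near_resonance(2)[OF y a pi_ge_zero order_refl]
      mathieu_sol_near_resonance(2)[OF v b pi_ge_zero order_refl]
    unfolding sin_pi_half by linarith+
  have "0 \<le> ?x pi * v pi"
    using assms(4) neg by (simp add: mathieu_cos_pi_def mult_nonpos_nonpos)
  then have "0 < y pi * ?u pi" using lt by linarith
  with neg show ?thesis by (simp add: mathieu_cos_pi_def zero_less_mult_iff)
qed

text \<open>The boundary conditions on \<open>u\<close> reduce the Wronskian to 0 at 0 and to
  \<open>x pi * v pi\<close> at \<open>pi\<close>. Its monotonicity then gives the sign of
  \<open>x pi\<close>, once \<open>a\<close> is far enough from \<open>b\<close> to outweigh the
  residual.\<close>

lemma mathieu_cos_pi_sign:
  assumes a: "\<bar>a - 1/4\<bar> + \<bar>e\<bar> \<le> 1/400"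
    and u: "\<And>t. (u has_real_derivative v t) (at t)"
    and v: "\<And>t. (v has_real_derivative - (e * cos t + b) * u t + r t) (at t)"
    and bc: "u pi = 0" "v 0 = 0" "v pi < 0"
    and close: "\<And>t. 0 \<le> t \<Longrightarrow> t \<le> pi \<Longrightarrow> \<bar>u t - cos (t/2)\<bar> \<le> 1/10"
    and r: "\<And>t. 0 \<le> t \<Longrightarrow> t \<le> pi \<Longrightarrow> \<bar>r t\<bar> \<le> \<rho>"
  shows "a > b + 8 * \<rho> \<Longrightarrow> mathieu_cos_pi a e < 0" "a < b - 8 * \<rho> \<Longrightarrow> mathieu_cos_pi a e > 0"
proof -
  let ?x = "mathieu_cos a e"
  obtain y where y: "mathieu_sol a e ?x y" "?x 0 = 1" "y 0 = 0" by (rule mathieu_cosE)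
  note W = wronskian_derivative[OF y(1) u v]
  show "mathieu_cos_pi a e < 0" if "a > b + 8 * \<rho>"
  proof -
    have "?x 0 * v 0 - y 0 * u 0 < ?x pi * v pi - y pi * u pi"
      by (rule wronskian_increasing[OF W _ close r])
        (use mathieu_sol_near_resonance(1)[OF y a] that in auto)
    then show ?thesis using bc y by (simp add: mathieu_cos_pi_def zero_less_mult_iff)
  qed
  show "mathieu_cos_pi a e > 0" if "a < b - 8 * \<rho>"
  proof -
    have "- (?x 0 * v 0 - y 0 * u 0) < - (?x pi * v pi - y pi * u pi)"
    proof (rule wronskian_increasing[where \<theta> = "b - a" and r = "\<lambda>t. - r t" and \<rho> = \<rho>])
      show "((\<lambda>t. - (?x t * v t - y t * u t)) has_real_derivative
          (b - a) * (?x t * u t) + ?x t * - r t) (at t)" for t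
        using DERIV_minus[OF W[of t]] by (simp add: algebra_simps)
    qed (use mathieu_sol_near_resonance(1)[OF y a] close r that in auto)
    then show ?thesis using bc y by (simp add: mathieu_cos_pi_def mult_less_0_iff)
  qed
qed

section \<open>An approximate antiperiodic solution\<close>

text \<open>These modes have zero derivative at 0 and vanish at \<open>pi\<close>, the boundary
  conditions that characterise a zero of \<open>mathieu_cos_pi\<close>.\<close>

definition half_cos :: "nat \<Rightarrow> real \<Rightarrow> real" where
  "half_cos n t = cos ((real n + 1/2) * t)"

lemma cos_mult_half_cos:
  "2 * (cos t * half_cos n t) = half_cos (Suc n) t + half_cos (n - 1) t"
proof (cases n)
  case 0
  have "2 * (cos t * cos (t / 2)) = cos (t - t/2) + cos (t + t/2)"
    unfolding cos_times_cos by simp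
  then show ?thesis using 0 by (simp add: half_cos_def field_simps)
next
  case (Suc m)
  have "2 * (cos t * half_cos n t) = cos (t - (real n + 1/2) * t) + cos (t + (real n + 1/2) * t)"
    unfolding cos_times_cos half_cos_def by simp
  also have "t - (real n + 1/2) * t = - ((real m + 1/2) * t)" by (simp add: Suc algebra_simps)
  finally show ?thesis unfolding cos_minus by (simp add: half_cos_def Suc algebra_simps)
qed

text \<open>Peels one coefficient off a polynomial in Horner form; repeated use leaves a numerical
  check on the sum of the absolute coefficients.\<close>

lemma abs_add_mult_le:
  fixes e :: real
  assumes "\<bar>e\<bar> \<le> 1" "\<bar>q\<bar> \<le> B - \<bar>p\<bar>"
  shows "\<bar>p + e * q\<bar> \<le> B"
  using assms mult_right_mono[OF assms(1), of "\<bar>q\<bar>"] abs_triangle_ineq[of p "e * q"]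
  by (simp add: abs_mult)

text \<open>The expansion of \<open>\<alpha> + \<mu>/4\<close> along the lower-order curve
  \<open>\<alpha>_-\<close>; its value at \<open>- e\<close> is the expansion along
  \<open>\<alpha>_+\<close>.\<close>

definition boundary_poly :: "real \<Rightarrow> real" where
  "boundary_poly e = 1/4 - 1/2 * e - 1/8 * e^2 + 1/32 * e^3 - 1/384 * e^4 - 11/4608 * e^5"

text \<open>Formal power series solution in \<open>e\<close>, truncated after \<open>e\<^sup>5\<close>, of the three-term recurrence for
  the coefficients of \<open>\<Sum>c\<^sub>n cos ((n + 1/2) t)\<close>, normalised by \<open>c\<^sub>0 = 1\<close>; \<open>floquet_residual\<close> is
  the remaining error divided by \<open>e\<^sup>6\<close>.\<close>

definition floquet_coeff :: "real \<Rightarrow> nat \<Rightarrow> real" where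
  "floquet_coeff e n =
     (if n = 0 then 1
      else if n = 1 then e * (1/4 + e * (-1/16 + e * (1/192 + e * (11/2304 + e * (-49/18432)))))
      else if n = 2 then e^2 * (1/48 + e * (-1/144 + e * (1/1536 + e * (7/12288))))
      else if n = 3 then e^3 * (1/1152 + e * (-1/3072 + e * (1/30720)))
      else if n = 4 then e^4 * (1/46080 + e * (-1/115200))
      else if n = 5 then e^5 * (1/2764800)
      else 0)"

definition floquet_residual :: "real \<Rightarrow> nat \<Rightarrow> real" where
  "floquet_residual e n =
     (if n = 0 then -49/36864
      else if n = 1 then 55/73728 + e * (91/147456 + e * (-191/1769472 + e * (-95/21233664 + e * (539/84934656))))
      else if n = 2 then -719/368640 + e * (-73/884736 + e * (347/10616832 + e * (-43/14155776 + e * (-77/56623104))))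
      else if n = 3 then 17/51200 + e * (-73/4423680 + e * (-11/53084160 + e * (49/70778880 + e * (-11/141557760))))
      else if n = 4 then 1/55296 + e * (13/7372800 + e * (-29/88473600 + e * (-31/1061683200 + e * (11/530841600))))
      else if n = 5 then -1/221184 + e * (-1/22118400 + e * (1/88473600 + e * (-1/1061683200 + e * (-11/12740198400))))
      else if n = 6 then 1/5529600
      else 0)"

text \<open>For \<open>n = 0\<close> the truncated \<open>n - 1 = 0\<close> is intended: \<open>cos (- t/2) = cos (t/2)\<close>.\<close>

lemma floquet_recurrence:
  assumes "n < 7"
  shows "(boundary_poly e - (real n + 1/2)^2) * floquet_coeff e n
     + e/2 * (floquet_coeff e (n - 1) + floquet_coeff e (Suc n)) = e^6 * floquet_residual e n"
proof -
  \<comment> \<open>The last nonzero coefficient has index 5, and it still contributes to row 6 as a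
    neighbour.\<close>
  from assms consider "n = 0" | "n = 1" | "n = 2" | "n = 3" | "n = 4" | "n = 5" | "n = 6" by linarith
  then show ?thesis
    by cases (simp_all add: boundary_poly_def floquet_coeff_def floquet_residual_def
      algebra_simps power_numeral_reduce)
qed

text \<open>The bound 1/7 makes the seven residual terms add up to at most 1.\<close>

lemma floquet_residual_le:
  assumes "\<bar>e\<bar> \<le> 1"
  shows "\<bar>floquet_residual e n\<bar> \<le> 1/7"
proof -
  have if_le: "\<bar>if c then p else q\<bar> \<le> B" if "\<bar>p\<bar> \<le> B" "\<bar>q\<bar> \<le> B" for c and p q B :: real
    using that by simp
  show ?thesis
    unfolding floquet_residual_def by (intro if_le abs_add_mult_le[OF assms]) simp_all
qed

lemma floquet_coeff_le:
  assumes "\<bar>e\<bar> \<le> 1" "0 < n"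
  shows "\<bar>floquet_coeff e n\<bar> \<le> \<bar>e\<bar>"
proof -
  have *: "\<bar>e ^ Suc k * q\<bar> \<le> \<bar>e\<bar>" if "\<bar>q\<bar> \<le> 1" for k q
  proof -
    have "\<bar>e\<bar> ^ k * \<bar>q\<bar> \<le> 1 * 1"
      using assms that by (intro mult_mono power_le_one) auto
    from mult_left_mono[OF this abs_ge_zero[of e]] show ?thesis
      by (simp add: abs_mult power_abs mult.assoc)
  qed
  have *: "\<bar>e ^ k * q\<bar> \<le> \<bar>e\<bar>" if "0 < k" "\<bar>q\<bar> \<le> 1" for k q
    using *[OF that(2), of "k - 1"] that(1) by simp
  from assms(2) consider "n = 1" | "n = 2" | "n = 3" | "n = 4" | "n = 5" | "n > 5" by linarith
  then show ?thesis
  proof cases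
    case 1
    have "\<bar>1/4 + e * (-1/16 + e * (1/192 + e * (11/2304 + e * (-49/18432))))\<bar> \<le> 1"
      by (intro abs_add_mult_le[OF assms(1)]) simp
    then show ?thesis using *[of 1] 1 by (simp add: floquet_coeff_def)
  next
    case 2
    have "\<bar>1/48 + e * (-1/144 + e * (1/1536 + e * (7/12288)))\<bar> \<le> 1"
      by (intro abs_add_mult_le[OF assms(1)]) simp
    then show ?thesis using *[of 2] 2 by (simp add: floquet_coeff_def)
  next
    case 3
    have "\<bar>1/1152 + e * (-1/3072 + e * (1/30720))\<bar> \<le> 1"
      by (intro abs_add_mult_le[OF assms(1)]) simp
    then show ?thesis using *[of 3] 3 by (simp add: floquet_coeff_def)
  next
    case 4
    have "\<bar>1/46080 + e * (-1/115200)\<bar> \<le> 1"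
      by (intro abs_add_mult_le[OF assms(1)]) simp
    then show ?thesis using *[of 4] 4 by (simp add: floquet_coeff_def)
  next
    case 5
    then show ?thesis using *[of 5 "1/2764800"] by (simp add: floquet_coeff_def)
  next
    case 6
    then show ?thesis by (simp add: floquet_coeff_def)
  qed
qed

lemma boundary_poly_near:
  assumes "\<bar>e\<bar> \<le> 1"
  shows "\<bar>boundary_poly e - 1/4\<bar> \<le> \<bar>e\<bar>"
proof -
  have "boundary_poly e - 1/4 = e * (-1/2 + e * (-1/8 + e * (1/32 + e * (-1/384 + e * (-11/4608)))))"
    by (simp add: boundary_poly_def power_numeral_reduce algebra_simps)
  moreover have "\<bar>-1/2 + e * (-1/8 + e * (1/32 + e * (-1/384 + e * (-11/4608))))\<bar> \<le> 1"
    by (intro abs_add_mult_le[OF assms]) simp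
  ultimately show ?thesis using mult_left_mono[of _ 1 "\<bar>e\<bar>"] by (simp add: abs_mult)
qed

definition approx_sol :: "real \<Rightarrow> real \<Rightarrow> real" where
  "approx_sol e t = (\<Sum>n<6. floquet_coeff e n * half_cos n t)"

definition approx_sol_deriv :: "real \<Rightarrow> real \<Rightarrow> real" where
  "approx_sol_deriv e t = (\<Sum>n<6. floquet_coeff e n * (- (real n + 1/2) * sin ((real n + 1/2) * t)))"

lemma approx_sol_has_derivative:
  "(approx_sol e has_real_derivative approx_sol_deriv e t) (at t)"
  unfolding approx_sol_def approx_sol_deriv_def half_cos_def
  by (auto intro!: derivative_eq_intros sum.cong simp: algebra_simps)

text \<open>Multiplication by \<open>cos t\<close> sends each mode to its two neighbours, so
  collecting coefficients mode by mode produces the left side of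
  \<open>floquet_recurrence\<close>.\<close>

lemma approx_sol_deriv_has_derivative:
  "(approx_sol_deriv e has_real_derivative - (e * cos t + boundary_poly e) * approx_sol e t
      + e^6 * (\<Sum>n<7. floquet_residual e n * half_cos n t)) (at t)"
proof -
  let ?c = "floquet_coeff e" and ?h = "\<lambda>n. half_cos n t"
  have "(approx_sol_deriv e has_real_derivative (\<Sum>n<6. ?c n * (- ((real n + 1/2)^2) * ?h n))) (at t)"
    unfolding approx_sol_deriv_def half_cos_def
    by (auto intro!: derivative_eq_intros sum.cong simp: algebra_simps power2_eq_square)
  moreover have "(\<Sum>n<6. ?c n * (- ((real n + 1/2)^2) * ?h n))
      = - (e * cos t + boundary_poly e) * approx_sol e t
        + e^6 * (\<Sum>n<7. floquet_residual e n * ?h n)"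
  proof -
    have c6: "?c 6 = 0" "?c 7 = 0" by (simp_all add: floquet_coeff_def)
    have "e * cos t * approx_sol e t = e/2 * (\<Sum>n<6. ?c n * (?h (Suc n) + ?h (n - 1)))"
      unfolding approx_sol_def sum_distrib_left cos_mult_half_cos[symmetric]
      by (simp add: algebra_simps)
    \<comment> \<open>Mode 0 receives \<open>?c 0\<close> from its own reflection and
      \<open>?c 1\<close> from above; mode 6 receives \<open>?c 5\<close>, hence the seventh
      term.\<close>
    also have "(\<Sum>n<6. ?c n * (?h (Suc n) + ?h (n - 1))) = (\<Sum>n<7. (?c (n - 1) + ?c (Suc n)) * ?h n)"
      using c6 by (simp add: eval_nat_numeral algebra_simps)
    finally have 1: "e * cos t * approx_sol e t = e/2 * (\<Sum>n<7. (?c (n - 1) + ?c (Suc n)) * ?h n)" .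
    have 2: "approx_sol e t = (\<Sum>n<7. ?c n * ?h n)"
      "(\<Sum>n<6. ?c n * (- ((real n + 1/2)^2) * ?h n)) = (\<Sum>n<7. ?c n * (- ((real n + 1/2)^2) * ?h n))"
      using c6 by (simp_all add: approx_sol_def eval_nat_numeral)
    have "e^6 * (\<Sum>n<7. floquet_residual e n * ?h n)
      = (\<Sum>n<7. ((boundary_poly e - (real n + 1/2)^2) * ?c n + e/2 * (?c (n - 1) + ?c (Suc n))) * ?h n)"
      unfolding sum_distrib_left mult.assoc[symmetric]
      by (intro sum.cong refl) (simp only: lessThan_iff floquet_recurrence)
    also have "\<dots> = boundary_poly e * (\<Sum>n<7. ?c n * ?h n)
        + (\<Sum>n<7. ?c n * (- ((real n + 1/2)^2) * ?h n)) + e/2 * (\<Sum>n<7. (?c (n - 1) + ?c (Suc n)) * ?h n)"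
      unfolding sum_distrib_left sum.distrib[symmetric]
      by (intro sum.cong refl) (simp add: algebra_simps)
    finally show ?thesis unfolding 1[symmetric] 2[symmetric] by (simp add: algebra_simps)
  qed
  ultimately show ?thesis by simp
qed

lemma abs_half_cos_le_one: "\<bar>half_cos n t\<bar> \<le> 1"
  by (simp add: half_cos_def)

lemma sum_residual_le:
  assumes "\<bar>e\<bar> \<le> 1"
  shows "\<bar>e^6 * (\<Sum>n<7. floquet_residual e n * half_cos n t)\<bar> \<le> e^6"
proof -
  have "\<bar>\<Sum>n<7. floquet_residual e n * half_cos n t\<bar> \<le> (\<Sum>n<(7::nat). 1/7)"
  proof (rule order_trans[OF sum_abs sum_mono])
    fix n
    show "\<bar>floquet_residual e n * half_cos n t\<bar> \<le> 1/7"
      using mult_mono[OF floquet_residual_le[OF assms] abs_half_cos_le_one[of n t]]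
      by (simp add: abs_mult)
  qed
  then show ?thesis using mult_left_mono[of _ 1 "e^6"] by (simp add: abs_mult)
qed

lemma approx_sol_close:
  assumes "\<bar>e\<bar> \<le> 1/1600"
  shows "\<bar>approx_sol e t - cos (t/2)\<bar> \<le> 1/10"
proof -
  have "approx_sol e t - cos (t/2) = (\<Sum>n<5. floquet_coeff e (Suc n) * half_cos (Suc n) t)"
    using sum.lessThan_Suc_shift[of "\<lambda>n. floquet_coeff e n * half_cos n t" 5]
    by (simp add: approx_sol_def floquet_coeff_def[of e 0] half_cos_def[of 0])
  also have "\<bar>\<dots>\<bar> \<le> (\<Sum>n<(5::nat). 1/1600)"
  proof (rule order_trans[OF sum_abs sum_mono])
    fix n
    have "\<bar>floquet_coeff e (Suc n)\<bar> \<le> 1/1600" using floquet_coeff_le[of e "Suc n"] assms by simp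
    from mult_mono[OF this abs_half_cos_le_one[of "Suc n" t]]
    show "\<bar>floquet_coeff e (Suc n) * half_cos (Suc n) t\<bar> \<le> 1/1600" by (simp add: abs_mult)
  qed
  finally show ?thesis by simp
qed

lemma approx_sol_boundary:
  assumes "\<bar>e\<bar> \<le> 1/1600"
  shows "approx_sol e pi = 0" "approx_sol_deriv e 0 = 0" "approx_sol_deriv e pi < 0"
proof -
  have "half_cos n pi = 0" for n
    by (simp add: half_cos_def distrib_right cos_add)
  then show "approx_sol e pi = 0" by (simp add: approx_sol_def)
  show "approx_sol_deriv e 0 = 0" by (simp add: approx_sol_deriv_def)
  let ?s = "\<lambda>n. floquet_coeff e n * (- (real n + 1/2) * sin ((real n + 1/2) * pi))"
  have "approx_sol_deriv e pi = - 1/2 + (\<Sum>n<5. ?s (Suc n))"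
    using sum.lessThan_Suc_shift[of ?s 5]
    by (simp add: approx_sol_deriv_def floquet_coeff_def[of e 0])
  \<comment> \<open>The largest frequency is 11/2, and five such terms cannot outweigh the leading
    -1/2.\<close>
  moreover have "\<bar>\<Sum>n<5. ?s (Suc n)\<bar> \<le> (\<Sum>n<(5::nat). 1/1600 * (11/2 * 1))"
  proof (rule order_trans[OF sum_abs sum_mono])
    fix n :: nat assume n: "n \<in> {..<5}"
    have "\<bar>floquet_coeff e (Suc n)\<bar> \<le> 1/1600" using floquet_coeff_le[of e "Suc n"] assms by simp
    then show "\<bar>?s (Suc n)\<bar> \<le> 1/1600 * (11/2 * 1)"
      unfolding abs_mult using n by (intro mult_mono) auto
  qed
  ultimately show "approx_sol_deriv e pi < 0" by (simp add: abs_le_iff)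
qed

text \<open>The comparison with \<open>approx_sol\<close> has residual at most \<open>e^6\<close>,
  whence the margin \<open>8 * e^6\<close>. The radii 1/1600 and 1/800 together stay within the
  1/400 of the a priori estimates.\<close>

lemma mathieu_cos_pi_sign_boundary_poly:
  assumes "\<bar>e\<bar> \<le> 1/1600" "\<bar>a - 1/4\<bar> \<le> 1/800"
  shows "a > boundary_poly e + 8 * e^6 \<Longrightarrow> mathieu_cos_pi a e < 0"
    "a < boundary_poly e - 8 * e^6 \<Longrightarrow> mathieu_cos_pi a e > 0"
proof -
  have near: "\<bar>a - 1/4\<bar> + \<bar>e\<bar> \<le> 1/400" using assms by simp
  have e: "\<bar>e\<bar> \<le> 1" using assms by simp
  note * = mathieu_cos_pi_sign[OF near approx_sol_has_derivative approx_sol_deriv_has_derivative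
    approx_sol_boundary[OF assms(1)] approx_sol_close[OF assms(1)] sum_residual_le[OF e]]
  show "a > boundary_poly e + 8 * e^6 \<Longrightarrow> mathieu_cos_pi a e < 0" by (rule *(1))
  show "a < boundary_poly e - 8 * e^6 \<Longrightarrow> mathieu_cos_pi a e > 0" by (rule *(2))
qed

section \<open>The boundary curves\<close>

text \<open>By \<open>mathieu_cos_pi_neg_mono\<close> the set below is an initial segment of the interval around \<open>1/4\<close>. Taking its
  supremum produces the zero of \<open>mathieu_cos_pi\<close> without any continuity in \<open>a\<close>.\<close>

definition boundary_curve :: "real \<Rightarrow> real" where
  "boundary_curve e = Sup {a. \<bar>a - 1/4\<bar> \<le> 1/800 \<and> mathieu_cos_pi a e \<ge> 0}"

text \<open>Below the supremum, a nonpositive value would by \<open>mathieu_cos_pi_neg_mono\<close>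
  make all larger members of the set negative. An error above \<open>8 * e^6\<close> would leave
  room for a point at which the supremum and \<open>mathieu_cos_pi_sign_boundary_poly\<close>
  prescribe opposite signs.\<close>

lemma boundary_curve_bounds:
  assumes e: "\<bar>e\<bar> \<le> 1/1600"
  shows boundary_curve_sign:
      "\<And>a. \<bar>a - 1/4\<bar> \<le> 1/800 \<Longrightarrow> a < boundary_curve e \<Longrightarrow> mathieu_cos_pi a e > 0"
      "\<And>a. \<bar>a - 1/4\<bar> \<le> 1/800 \<Longrightarrow> a > boundary_curve e \<Longrightarrow> mathieu_cos_pi a e < 0"
    and boundary_curve_approx: "\<bar>boundary_curve e - boundary_poly e\<bar> \<le> 8 * e^6"
proof -
  let ?S = "{a. \<bar>a - 1/4\<bar> \<le> 1/800 \<and> mathieu_cos_pi a e \<ge> 0}"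
  have p: "\<bar>boundary_poly e - 1/4\<bar> \<le> 1/1600" using boundary_poly_near[of e] e by simp
  have "\<bar>e\<bar> ^ 6 \<le> (1/1600) ^ 6" using e by (intro power_mono) auto
  moreover have "8 * (1/1600) ^ 6 < (1/1600 :: real)" by (simp add: power_divide)
  ultimately have e6: "8 * e^6 < 1/1600" "0 \<le> e^6" by (simp_all add: power_even_abs)
  \<comment> \<open>The left end of the window belongs to the set, so the supremum is taken over a
    nonempty set.\<close>
  have "1/4 - 1/800 < boundary_poly e - 8 * e^6" using p e6 by linarith
  then have "mathieu_cos_pi (1/4 - 1/800) e > 0"
    by (intro mathieu_cos_pi_sign_boundary_poly(2)[OF e]) simp_all
  then have mem: "1/4 - 1/800 \<in> ?S" by simp
  have ub: "a \<le> 1/4 + 1/800" if "a \<in> ?S" for a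
    using that unfolding mem_Collect_eq by linarith
  then have bdd: "bdd_above ?S" by (rule bdd_aboveI)
  have range: "1/4 - 1/800 \<le> boundary_curve e" "boundary_curve e \<le> 1/4 + 1/800"
    unfolding boundary_curve_def using cSup_upper[OF mem bdd] cSup_least[of ?S, OF _ ub] mem by blast+
  show pos: "mathieu_cos_pi a e > 0" if a: "\<bar>a - 1/4\<bar> \<le> 1/800" "a < boundary_curve e" for a
  proof (rule ccontr)
    assume "\<not> mathieu_cos_pi a e > 0"
    moreover obtain b where "b \<in> ?S" "a < b"
      using less_cSupD[of ?S a] mem a(2) unfolding boundary_curve_def by blast
    ultimately show False
      using mathieu_cos_pi_neg_mono[of a e b] a(1) e by simp
  qed
  show neg: "mathieu_cos_pi a e < 0" if a: "\<bar>a - 1/4\<bar> \<le> 1/800" "a > boundary_curve e" for a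
    using a cSup_upper[of a ?S, OF _ bdd] unfolding boundary_curve_def by force
  show "\<bar>boundary_curve e - boundary_poly e\<bar> \<le> 8 * e^6"
  proof (rule ccontr)
    assume "\<not> ?thesis"
    then consider "boundary_curve e < boundary_poly e - 8 * e^6"
      | "boundary_curve e > boundary_poly e + 8 * e^6" by linarith
    then show False
    proof cases
      case 1
      then obtain a where a: "boundary_curve e < a" "a < boundary_poly e - 8 * e^6"
        using dense by blast
      then have "\<bar>a - 1/4\<bar> \<le> 1/800" using range p e6 unfolding abs_le_iff by linarith
      then show False using neg[of a] mathieu_cos_pi_sign_boundary_poly(2)[OF e, of a] a by simp
    next
      case 2
      then obtain a where a: "a < boundary_curve e" "boundary_poly e + 8 * e^6 < a"
        using dense by blast
      then have "\<bar>a - 1/4\<bar> \<le> 1/800" using range p e6 unfolding abs_le_iff by linarith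
      then show False using pos[of a] mathieu_cos_pi_sign_boundary_poly(1)[OF e, of a] a by simp
    qed
  qed
qed

lemma stability_boundary_curves:
  "stability_boundary \<mu> (\<lambda>e. boundary_curve e - \<mu> / 4) (\<lambda>e. boundary_curve (- e) - \<mu> / 4)"
proof -
  \<comment> \<open>At \<open>e = 0\<close> the error bound \<open>8 * e^6\<close> vanishes, so the
    value is exact.\<close>
  have "boundary_curve 0 = 1/4"
    using boundary_curve_approx[of 0] by (simp add: boundary_poly_def)
  moreover have
    "(\<alpha> \<in> open_segment (boundary_curve e - \<mu> / 4) (boundary_curve (- e) - \<mu> / 4) \<longrightarrow>
        unstable (linearized_H \<mu> \<alpha> e)) \<and>
     (\<alpha> \<notin> closed_segment (boundary_curve e - \<mu> / 4) (boundary_curve (- e) - \<mu> / 4) \<longrightarrow>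
        stable (linearized_H \<mu> \<alpha> e))"
    if e: "0 < e" "e < 1/1600" and \<alpha>: "\<bar>\<alpha> - resonance_alpha \<mu>\<bar> < 1/800" for e \<alpha>
  proof -
    define a where "a = \<alpha> + \<mu> / 4"
    have a: "\<bar>a - 1/4\<bar> \<le> 1/800"
    proof -
      have "a - 1/4 = \<alpha> - resonance_alpha \<mu>" by (simp add: a_def resonance_alpha_def field_simps)
      then show ?thesis using \<alpha> by simp
    qed
    have e': "\<bar>e\<bar> \<le> 1/1600" "\<bar>- e\<bar> \<le> 1/1600" using e by simp_all
    note sign = boundary_curve_sign[OF e'(1) a] boundary_curve_sign[OF e'(2) a]
    \<comment> \<open>With both factors at most 1/10 in modulus, only the sign of the product
      decides stability.\<close>
    have "\<bar>mathieu_cos_pi a e * mathieu_cos_pi a (- e)\<bar> \<le> 1/10 * (1/10)"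
      unfolding abs_mult using a e' by (intro mult_mono mathieu_cos_pi_abs_le) auto
    then have lt1: "mathieu_cos_pi a e * mathieu_cos_pi a (- e) < 1" by linarith
    show ?thesis
    proof (intro conjI impI)
      assume "\<alpha> \<in> open_segment (boundary_curve e - \<mu> / 4) (boundary_curve (- e) - \<mu> / 4)"
      \<comment> \<open>Segments are unordered, so both orders of the two curves are treated
        alike.\<close>
      then have "boundary_curve e < a \<and> a < boundary_curve (- e) \<or>
          boundary_curve (- e) < a \<and> a < boundary_curve e"
        by (auto simp: open_segment_eq_real_ivl a_def split: if_splits)
      then have "mathieu_cos_pi a e * mathieu_cos_pi a (- e) < 0"
        using sign by (auto simp: mult_less_0_iff)
      then show "unstable (linearized_H \<mu> \<alpha> e)"
        unfolding a_def by (rule unstable_if_mathieu_cos_pi)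
    next
      assume "\<alpha> \<notin> closed_segment (boundary_curve e - \<mu> / 4) (boundary_curve (- e) - \<mu> / 4)"
      then have "a < boundary_curve e \<and> a < boundary_curve (- e) \<or>
          boundary_curve (- e) < a \<and> boundary_curve e < a"
        by (auto simp: closed_segment_eq_real_ivl a_def split: if_splits)
      then have "0 < mathieu_cos_pi a e * mathieu_cos_pi a (- e)"
        using sign by (auto simp: zero_less_mult_iff)
      with lt1 show "stable (linearized_H \<mu> \<alpha> e)"
        unfolding a_def by (intro stable_if_mathieu_cos_pi)
    qed
  qed
  ultimately show ?thesis
    unfolding stability_boundary_def
    by (intro exI[of _ "1/1600"] exI[of _ "1/800"] conjI) (auto simp: resonance_alpha_def field_simps)
qed

text \<open>The cases \<open>s = 1\<close> and \<open>s = - 1\<close> are the two curves; the same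
  constant 8 serves both since \<open>e^6\<close> is even.\<close>

lemma boundary_curve_bigo:
  assumes "\<bar>s\<bar> = 1"
  shows "(\<lambda>e. boundary_curve (s * e) - boundary_poly (s * e)) \<in> O[at_right 0](\<lambda>e. e^6)"
proof (rule bigoI[of _ 8])
  have "eventually (\<lambda>e::real. e \<in> {0<..<1/1600}) (at_right 0)"
    by (rule eventually_at_right_real) simp
  then show "\<forall>\<^sub>F e in at_right 0. norm (boundary_curve (s * e) - boundary_poly (s * e)) \<le> 8 * norm (e^6)"
  proof eventually_elim
    case (elim e)
    have "s^6 = \<bar>s\<bar>^6" by (simp add: power_abs)
    with boundary_curve_approx[of "s * e"] assms elim show ?case
      by (simp add: abs_mult power_mult_distrib)
  qed
qed

theorem mainTheorem2:
  "\<exists>\<alpha>\<^sub>m \<alpha>\<^sub>p :: real \<Rightarrow> real \<Rightarrow> real. \<forall>\<mu>.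
     stability_boundary \<mu> (\<alpha>\<^sub>m \<mu>) (\<alpha>\<^sub>p \<mu>) \<and>
     (\<lambda>\<epsilon>. \<alpha>\<^sub>m \<mu> \<epsilon> - ((1 - \<mu>)/4 - 1/2 * \<epsilon> - 1/8 * \<epsilon>^2 + 1/32 * \<epsilon>^3
                        - 1/384 * \<epsilon>^4 - 11/4608 * \<epsilon>^5)) \<in> O[at_right 0](\<lambda>\<epsilon>. \<epsilon>^6) \<and>
     (\<lambda>\<epsilon>. \<alpha>\<^sub>p \<mu> \<epsilon> - ((1 - \<mu>)/4 + 1/2 * \<epsilon> - 1/8 * \<epsilon>^2 - 1/32 * \<epsilon>^3
                        - 1/384 * \<epsilon>^4 + 11/4608 * \<epsilon>^5)) \<in> O[at_right 0](\<lambda>\<epsilon>. \<epsilon>^6)"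
proof (intro exI allI conjI)
  fix \<mu> :: real
  \<comment> \<open>This goal fixes the witnesses: \<mu> enters only through the shift
    \<open>a = \<alpha> + \<mu>/4\<close>, and the two curves differ by the sign of
    \<open>e\<close>.\<close>
  show "stability_boundary \<mu> ((\<lambda>\<mu> e. boundary_curve e - \<mu> / 4) \<mu>) ((\<lambda>\<mu> e. boundary_curve (- e) - \<mu> / 4) \<mu>)"
    using stability_boundary_curves by simp
  have "(\<lambda>\<epsilon>. boundary_curve \<epsilon> - \<mu> / 4 - ((1 - \<mu>)/4 - 1/2 * \<epsilon> - 1/8 * \<epsilon>^2 + 1/32 * \<epsilon>^3
                        - 1/384 * \<epsilon>^4 - 11/4608 * \<epsilon>^5))
      = (\<lambda>\<epsilon>. boundary_curve (1 * \<epsilon>) - boundary_poly (1 * \<epsilon>))"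
    by (rule ext) (simp add: boundary_poly_def diff_divide_distrib)
  then show "(\<lambda>\<epsilon>. (\<lambda>\<mu> e. boundary_curve e - \<mu> / 4) \<mu> \<epsilon> - ((1 - \<mu>)/4 - 1/2 * \<epsilon> - 1/8 * \<epsilon>^2 + 1/32 * \<epsilon>^3
                        - 1/384 * \<epsilon>^4 - 11/4608 * \<epsilon>^5)) \<in> O[at_right 0](\<lambda>\<epsilon>. \<epsilon>^6)"
    using boundary_curve_bigo[of 1] by (simp only: abs_one)
  have "(\<lambda>\<epsilon>. boundary_curve (- \<epsilon>) - \<mu> / 4 - ((1 - \<mu>)/4 + 1/2 * \<epsilon> - 1/8 * \<epsilon>^2 - 1/32 * \<epsilon>^3
                        - 1/384 * \<epsilon>^4 + 11/4608 * \<epsilon>^5))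
      = (\<lambda>\<epsilon>. boundary_curve (- 1 * \<epsilon>) - boundary_poly (- 1 * \<epsilon>))"
    by (rule ext) (simp add: boundary_poly_def diff_divide_distrib)
  then show "(\<lambda>\<epsilon>. (\<lambda>\<mu> e. boundary_curve (- e) - \<mu> / 4) \<mu> \<epsilon> - ((1 - \<mu>)/4 + 1/2 * \<epsilon> - 1/8 * \<epsilon>^2 - 1/32 * \<epsilon>^3
                        - 1/384 * \<epsilon>^4 + 11/4608 * \<epsilon>^5)) \<in> O[at_right 0](\<lambda>\<epsilon>. \<epsilon>^6)"
    using boundary_curve_bigo[of "- 1"] by (simp only: abs_minus_cancel abs_one)
qed

end
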